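(* Let a vector $\mathbf x\in\mathbb R^{I_1\cdots I_N}$ and a matrix $\mathbf A\in\mathbb R^{I_1\cdots I_N\times I_1\cdots I_N}$ be represented by vector TT and matrix TT decompositions $$\mathbf x=\widetilde{\mathbf X}^{(1)}\,|\!\otimes\!|\,\cdots\,|\!\otimes\!|\,\widetilde{\mathbf X}^{(N)},\qquad \mathbf A=\widetilde{\mathbf A}^{(1)}\,|\!\otimes\!|\,\cdots\,|\!\otimes\!|\,\widetilde{\mathbf A}^{(N)},$$ with block matrices $\widetilde{\mathbf X}^{(m)}=[\mathbf x^{(m)}_{r_{m-1},r_m}]\in\mathbb R^{R_{m-1}I_m\times R_m}$ having blocks $\mathbf x^{(m)}_{r_{m-1},r_m}\in\mathbb R^{I_m}$, and $\widetilde{\mathbf A}^{(m)}=[\mathbf A^{(m)}_{r^A_{m-1},r^A_m}]\in\mathbb R^{R^A_{m-1}I_m\times R^A_mI_m}$ having blocks in $\mathbb R^{I_m\times I_m}$, where $R_0=R_N=R^A_0=R^A_N=1$. For a fixed $n\in\{1,\ldots,N\}$, let $\mathbf X^{\neq n}\in\mathbb R^{I_1\cdots I_N\times R_{n-1}I_nR_n}$ be the $n$th frame matrix of this TT decomposition of $\mathbf x$ and $$\overline{\mathbf A}_n=(\mathbf X^{\neq n})^\top\mathbf A\mathbf X^{\neq n}\in\mathbb R^{R_{n-1}I_nR_n\times R_{n-1}I_nR_n}.$$ Then for any vectors $\mathbf y^{(n)},\mathbf w^{(n)}\in\mathbb R^{R_{n-1}I_nR_n}$, $$\mathbf y^{(n)\top}\,\overline{\mathbf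 A}_n\,\mathbf w^{(n)}=\widetilde{\mathbf Z}^{(1)}\,|\!\otimes\!|\,\cdots\,|\!\otimes\!|\,\widetilde{\mathbf Z}^{(N)}\in\mathbb R,$$ with block matrices $$\widetilde{\mathbf Z}^{(m)}=\widetilde{\mathbf X}^{(m)}\times^1\widetilde{\mathbf A}^{(m)}\times^1\widetilde{\mathbf X}^{(m)}\in\mathbb R^{R^A_{m-1}R_{m-1}^2\times R^A_mR_m^2},\quad m\in\{1,\ldots,N\}\setminus\{n\},$$ $$\widetilde{\mathbf Z}^{(n)}=\widetilde{\mathbf Y}^{(n)}\times^1\widetilde{\mathbf A}^{(n)}\times^1\widetilde{\mathbf W}^{(n)}\in\mathbb R^{R^A_{n-1}R_{n-1}^2\times R^A_nR_n^2},$$ where $\underline{\mathbf Y}^{(n)},\underline{\mathbf W}^{(n)}\in\mathbb R^{R_{n-1}\times I_n\times R_n}$ are the 3rd-order tensors with $\mathbf y^{(n)}=\mathrm{vec}(\underline{\mathbf Y}^{(n)})$, $\mathbf w^{(n)}=\mathrm{vec}(\underline{\mathbf W}^{(n)})$, and $\widetilde{\mathbf Y}^{(n)}=[\underline{\mathbf Y}^{(n)}(r_{n-1},:,r_n)]$, $\widetilde{\mathbf W}^{(n)}=[\underline{\mathbf W}^{(n)}(r_{n-1},:,r_n)]\in\mathbb R^{R_{n-1}I_n\times R_n}$ are the block matrices partitioned with the fiber vectors in $\mathbb R^{I_n}$.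
   Context: Multi-index: $\overline{i_1i_2\cdots i_N}=i_N+(i_{N-1}-1)I_N+\cdots+(i_1-1)I_2I_3\cdots I_N$ (last index fastest). For a real tensor $\underline{\mathbf X}\in\mathbb R^{I_1\times\cdots\times I_N}$: $(\mathrm{vec}(\underline{\mathbf X}))_{\overline{i_1\cdots i_N}}=(\mathbf X_{(n)})_{i_n,\overline{i_1\cdots i_{n-1}i_{n+1}\cdots i_N}}=\underline{\mathbf X}(i_1,\ldots,i_N)$ defines the vectorization and the mode-$n$ matricization $\mathbf X_{(n)}$. Entries of vectors and matrices of sizes such as $I_1\cdots I_N$ are indexed by the multi-indices. $\otimes$ is the usual Kronecker product. Strong Kronecker product: for block matrices $\mathbf B=[\mathbf B_{r_1,r_2}]$ with $R_1\times R_2$ blocks of size $I_1\times J_1$ and $\mathbf C=[\mathbf C_{r_2,r_3}]$ with $R_2\times R_3$ blocks of size $I_2\times J_2$, $\mathbf B\,|\!\otimes\!|\,\mathbf C$ is the block matrix with $R_1\times R_3$ blocks $\sum_{r_2=1}^{R_2}\mathbf B_{r_1,r_2}\otimes\mathbf C_{r_2,r_3}$ of size $I_1I_2\times J_1J_2$. It is associative. (Vectors are blocks with one column; scalars are $1\times1$ blocks, in which case the strong Kronecker product is ordinary matrix multiplication.) Contracted product of block tensors: $[\mathbf B_{r_1,r_2}]\times^1[\mathbf C_{s_1,s_2}]$ is the block tensor whose block at position $(\overline{r_1s_1},\overline{r_2s_2})$ is $\mathbf B_{r_1,r_2}\times^1\mathbf C_{s_1,s_2}$, where $\times^1$ between tensors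 sums over the last mode of the first and the first mode of the second (vectors being 1st-order tensors, so $\mathbf p\times^1\mathbf A\times^1\mathbf q=\mathbf p^\top\mathbf A\mathbf q$). In particular $\widetilde{\mathbf Y}^{(n)}\times^1\widetilde{\mathbf A}^{(n)}\times^1\widetilde{\mathbf W}^{(n)}$ has scalar blocks, the one at $(\overline{r'_{n-1}r^A_{n-1}r_{n-1}},\overline{r'_nr^A_nr_n})$ being $\underline{\mathbf Y}^{(n)}(r'_{n-1},:,r'_n)^\top\mathbf A^{(n)}_{r^A_{n-1},r^A_n}\underline{\mathbf W}^{(n)}(r_{n-1},:,r_n)$, and similarly for $\widetilde{\mathbf X}^{(m)}\times^1\widetilde{\mathbf A}^{(m)}\times^1\widetilde{\mathbf X}^{(m)}$. Frame matrix: the TT-cores of $\mathbf x$ are the tensors $\underline{\mathbf X}^{(m)}\in\mathbb R^{R_{m-1}\times I_m\times R_m}$ with fibers $\underline{\mathbf X}^{(m)}(r_{m-1},:,r_m)=\mathbf x^{(m)}_{r_{m-1},r_m}$. Dropping singleton boundary modes, $\underline{\mathbf X}^{<n}=\underline{\mathbf X}^{(1)}\times^1\cdots\times^1\underline{\mathbf X}^{(n-1)}\in\mathbb R^{I_1\times\cdots\times I_{n-1}\times R_{n-1}}$, $\underline{\mathbf X}^{>n}=\underline{\mathbf X}^{(n+1)}\times^1\cdots\times^1\underline{\mathbf X}^{(N)}\in\mathbb R^{R_n\times I_{n+1}\times\cdots\times I_N}$, $\underline{\mathbf X}^{<1}=\underline{\mathbf X}^{>N}=1$, and $$\mathbf X^{\neq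 n}=\left(\mathbf X^{<n}_{(n)}\right)^\top\otimes\mathbf I_{I_n}\otimes\left(\mathbf X^{>n}_{(1)}\right)^\top,$$ where $\mathbf X^{<n}_{(n)}\in\mathbb R^{R_{n-1}\times I_1\cdots I_{n-1}}$ and $\mathbf X^{>n}_{(1)}\in\mathbb R^{R_n\times I_{n+1}\cdots I_N}$ are matricizations along the last and first mode respectively. *)

theory Defs
  imports "Jordan_Normal_Form.Matrix"
begin

(* All indices of vectors, matrices and tensors run from 0; modes of a tensor, cores and
   ranks keep their mathematical numbering (modes and cores from 1, ranks from 0). *)

section \<open>Multi-indices\<close>

definition indices :: "nat list \<Rightarrow> nat list set" where
  "indices ds = {is. list_all2 (<) is ds}"

text \<open>The last index varies fastest: with indices from 0 this is
  \<open>i\<^sub>N + i\<^sub>N\<^sub>-\<^sub>1 I\<^sub>N + \<dots> + i\<^sub>1 I\<^sub>2 \<dots> I\<^sub>N\<close>.\<close>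

fun multi_index :: "nat list \<Rightarrow> nat list \<Rightarrow> nat" where
  "multi_index (d # ds) (i # is) = i * prod_list ds + multi_index ds is"
| "multi_index _ _ = 0"

fun multi_index_inv :: "nat list \<Rightarrow> nat \<Rightarrow> nat list" where
  "multi_index_inv [] j = []"
| "multi_index_inv (d # ds) j = j div prod_list ds # multi_index_inv ds (j mod prod_list ds)"

lemma indices_Nil [simp]: "is \<in> indices [] \<longleftrightarrow> is = []"
  by (simp add: indices_def)

lemma indices_Cons:
  "is \<in> indices (d # ds) \<longleftrightarrow> (\<exists>i js. is = i # js \<and> i < d \<and> js \<in> indices ds)"
  by (auto simp: indices_def list_all2_Cons2)

lemma multi_index_less: "is \<in> indices ds \<Longrightarrow> multi_index ds is < prod_list ds"
proof (induction ds arbitrary: "is")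
  case (Cons d ds)
  then obtain i js where *: "is = i # js" "i < d" "js \<in> indices ds"
    by (auto simp: indices_Cons)
  with Cons.IH[of js] have "multi_index (d # ds) is < Suc i * prod_list ds" by simp
  also have "\<dots> \<le> d * prod_list ds" using * by (intro mult_le_mono1) simp
  finally show ?case by simp
qed simp

lemma multi_index_inv_multi_index:
  "is \<in> indices ds \<Longrightarrow> multi_index_inv ds (multi_index ds is) = is"
proof (induction ds arbitrary: "is")
  case (Cons d ds)
  then obtain i js where *: "is = i # js" "js \<in> indices ds"
    by (auto simp: indices_Cons)
  with Cons.IH[of js] multi_index_less[of js ds] show ?case by simp
qed simp

lemma multi_index_inv_in_indices: "j < prod_list ds \<Longrightarrow> multi_index_inv ds j \<in> indices ds"
proof (induction ds arbitrary: j)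
  case (Cons d ds)
  then have "0 < prod_list ds" by (cases "prod_list ds = 0") auto
  with Cons show ?case by (simp add: indices_Cons less_mult_imp_div_less)
qed simp

lemma multi_index_multi_index_inv:
  "j < prod_list ds \<Longrightarrow> multi_index ds (multi_index_inv ds j) = j"
proof (induction ds arbitrary: j)
  case (Cons d ds)
  then have "0 < prod_list ds" by (cases "prod_list ds = 0") auto
  with Cons show ?case by simp
qed simp


section \<open>Real tensors of arbitrary order\<close>

text \<open>The entry function vanishes outside the index range, so that tensors are extensional.\<close>

typedef tensor = "{(ds :: nat list, f :: nat list \<Rightarrow> real). \<forall>is. is \<notin> indices ds \<longrightarrow> f is = 0}"
  by (rule exI[of _ "([], \<lambda>_. 0)"]) simp

definition dims :: "tensor \<Rightarrow> nat list" where
  "dims T = fst (Rep_tensor T)"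

definition entry :: "tensor \<Rightarrow> nat list \<Rightarrow> real" where
  "entry T = snd (Rep_tensor T)"

definition tensor_of :: "nat list \<Rightarrow> (nat list \<Rightarrow> real) \<Rightarrow> tensor" where
  "tensor_of ds f = Abs_tensor (ds, \<lambda>is. if is \<in> indices ds then f is else 0)"

lemma Rep_tensor_of: "Rep_tensor (tensor_of ds f) = (ds, \<lambda>is. if is \<in> indices ds then f is else 0)"
  unfolding tensor_of_def by (rule Abs_tensor_inverse) auto

lemma dims_tensor_of [simp]: "dims (tensor_of ds f) = ds"
  by (simp add: dims_def Rep_tensor_of)

lemma entry_tensor_of [simp]: "is \<in> indices ds \<Longrightarrow> entry (tensor_of ds f) is = f is"
  by (simp add: entry_def Rep_tensor_of)

lemma tensor_eqI:
  assumes "dims S = dims T" "\<And>is. is \<in> indices (dims T) \<Longrightarrow> entry S is = entry T is"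
  shows "S = T"
proof -
  have out: "entry U is = 0" if "is \<notin> indices (dims U)" for U "is"
    using that Rep_tensor[of U] by (auto simp: entry_def dims_def)
  have "entry S = entry T"
    using assms out[of _ S] out[of _ T] by (intro ext) metis
  with assms(1) have "Rep_tensor S = Rep_tensor T"
    by (simp add: entry_def dims_def prod_eq_iff)
  then show ?thesis by (simp add: Rep_tensor_inject)
qed

definition vectorize :: "tensor \<Rightarrow> real vec" where
  "vectorize T = vec (prod_list (dims T)) (\<lambda>j. entry T (multi_index_inv (dims T) j))"

lemma vectorize_index:
  "is \<in> indices (dims T) \<Longrightarrow> vectorize T $ multi_index (dims T) is = entry T is"
  by (simp add: vectorize_def multi_index_less multi_index_inv_multi_index)

lemma vectorize_bij:
  assumes "v \<in> carrier_vec (prod_list ds)"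
  shows "\<exists>!T. dims T = ds \<and> vectorize T = v"
proof (rule ex1I)
  have "vectorize (tensor_of ds (\<lambda>is. v $ multi_index ds is)) = v"
    using assms
    by (intro eq_vecI) (auto simp: vectorize_def multi_index_inv_in_indices multi_index_multi_index_inv)
  then show "dims (tensor_of ds (\<lambda>is. v $ multi_index ds is)) = ds \<and>
    vectorize (tensor_of ds (\<lambda>is. v $ multi_index ds is)) = v" by simp
next
  fix T assume "dims T = ds \<and> vectorize T = v"
  then show "T = tensor_of ds (\<lambda>is. v $ multi_index ds is)"
    using vectorize_index[of _ T] by (intro tensor_eqI) auto
qed

definition drop_mode :: "nat \<Rightarrow> 'a list \<Rightarrow> 'a list" where
  "drop_mode n xs = take (n - 1) xs @ drop n xs"

definition insert_mode :: "nat \<Rightarrow> 'a \<Rightarrow> 'a list \<Rightarrow> 'a list" where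
  "insert_mode n x xs = take (n - 1) xs @ x # drop (n - 1) xs"

text \<open>Mode-\<open>n\<close> matricization, for \<open>1 \<le> n \<le> length (dims T)\<close>.\<close>

definition matricize :: "nat \<Rightarrow> tensor \<Rightarrow> real mat" where
  "matricize n T = (let ds = dims T; es = drop_mode n ds in
     mat (ds ! (n - 1)) (prod_list es)
       (\<lambda>(i, j). entry T (insert_mode n i (multi_index_inv es j))))"

lemma matricize_index:
  assumes "1 \<le> n" "n \<le> length (dims T)" "is \<in> indices (dims T)"
  shows "matricize n T $$ (is ! (n - 1), multi_index (drop_mode n (dims T)) (drop_mode n is)) = entry T is"
proof -
  have la: "list_all2 (<) is (dims T)" using assms(3) by (simp add: indices_def)
  then have len: "length is = length (dims T)" by (rule list_all2_lengthD)
  have in_es: "drop_mode n is \<in> indices (drop_mode n (dims T))"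
    using la by (auto simp: indices_def drop_mode_def intro!: list_all2_appendI)
  have lt: "n - 1 < length is" using assms(1,2) len by linarith
  have "insert_mode n (is ! (n - 1)) (drop_mode n is) = is"
    using assms(1,2) len lt id_take_nth_drop[of "n - 1" "is", symmetric]
    by (simp add: insert_mode_def drop_mode_def min_def)
  moreover have "is ! (n - 1) < dims T ! (n - 1)"
    using list_all2_nthD[OF la lt] .
  ultimately show ?thesis
    using in_es by (simp add: matricize_def Let_def multi_index_less multi_index_inv_multi_index)
qed

text \<open>Summation over the last mode of the first and the first mode of the second tensor.\<close>

definition contract :: "tensor \<Rightarrow> tensor \<Rightarrow> tensor" (infixl "\<times>\<^sup>1" 70) where
  "S \<times>\<^sup>1 T = (let p = length (dims S) - 1 in
     tensor_of (butlast (dims S) @ tl (dims T))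
       (\<lambda>is. \<Sum>k < last (dims S). entry S (take p is @ [k]) * entry T (k # drop p is)))"

definition tensor_of_vec :: "real vec \<Rightarrow> tensor" where
  "tensor_of_vec v = tensor_of [dim_vec v] (\<lambda>is. v $ (is ! 0))"

definition tensor_of_mat :: "real mat \<Rightarrow> tensor" where
  "tensor_of_mat M = tensor_of [dim_row M, dim_col M] (\<lambda>is. M $$ (is ! 0, is ! 1))"

definition drop_first_mode :: "tensor \<Rightarrow> tensor" where
  "drop_first_mode T = tensor_of (tl (dims T)) (\<lambda>is. entry T (0 # is))"

definition drop_last_mode :: "tensor \<Rightarrow> tensor" where
  "drop_last_mode T = tensor_of (butlast (dims T)) (\<lambda>is. entry T (is @ [0]))"


section \<open>Block matrices\<close>

text \<open>A block matrix is a matrix whose entries are its blocks (matrices, vectors or tensors).\<close>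

definition block_mats :: "nat \<Rightarrow> nat \<Rightarrow> 'a set \<Rightarrow> 'a mat set" where
  "block_mats p q S = {B \<in> carrier_mat p q. elements_mat B \<subseteq> S}"

definition single_block :: "'a \<Rightarrow> 'a mat" where
  "single_block M = mat 1 1 (\<lambda>_. M)"

definition scalar_matrix :: "real \<Rightarrow> real mat" where
  "scalar_matrix c = mat 1 1 (\<lambda>_. c)"

definition column_matrix :: "real vec \<Rightarrow> real mat" where
  "column_matrix v = mat_of_cols (dim_vec v) [v]"

definition vec_blocks :: "real vec mat \<Rightarrow> real mat mat" where
  "vec_blocks = map_mat column_matrix"

definition scalar_blocks :: "tensor mat \<Rightarrow> real mat mat" where
  "scalar_blocks = map_mat (\<lambda>t. scalar_matrix (entry t []))"

definition kronecker :: "real mat \<Rightarrow> real mat \<Rightarrow> real mat" (infixl "\<otimes>\<^sub>K" 70) where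
  "A \<otimes>\<^sub>K B = mat (dim_row A * dim_row B) (dim_col A * dim_col B)
     (\<lambda>(i, j). A $$ (i div dim_row B, j div dim_col B) * B $$ (i mod dim_row B, j mod dim_col B))"

text \<open>The sum of the blocks \<open>B\<^sub>r\<^sub>s \<otimes>\<^sub>K C\<^sub>s\<^sub>t\<close> over \<open>s\<close> is written out
  entrywise, since matrices do not form a \<open>comm_monoid_add\<close>; its size is that of the summand
  \<open>s = 0\<close>, so there must be at least one summand and equally sized blocks.\<close>

definition strong_kronecker :: "real mat mat \<Rightarrow> real mat mat \<Rightarrow> real mat mat"
    (infixl "|\<otimes>|" 70) where
  "B |\<otimes>| C = mat (dim_row B) (dim_col C) (\<lambda>(r, t).
     let summand = (\<lambda>s. B $$ (r, s) \<otimes>\<^sub>K C $$ (s, t)) in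
     mat (dim_row (summand 0)) (dim_col (summand 0)) (\<lambda>ij. \<Sum>s < dim_col B. summand s $$ ij))"

definition strong_kronecker_chain :: "(nat \<Rightarrow> real mat mat) \<Rightarrow> nat \<Rightarrow> real mat mat" where
  "strong_kronecker_chain B N = foldl (|\<otimes>|) (B 1) (map B [2..<Suc N])"

definition block_contract :: "tensor mat \<Rightarrow> tensor mat \<Rightarrow> tensor mat" (infixl "\<times>\<^sub>b\<^sup>1" 70) where
  "B \<times>\<^sub>b\<^sup>1 C = mat (dim_row B * dim_row C) (dim_col B * dim_col C)
     (\<lambda>(i, j). B $$ (i div dim_row C, j div dim_col C) \<times>\<^sup>1 C $$ (i mod dim_row C, j mod dim_col C))"

text \<open>The block matrix of mode-2 fibers of a tensor of order 3, and its inverse (which takes the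
  size of the blocks as first argument).\<close>

definition fiber_blocks :: "tensor \<Rightarrow> real vec mat" where
  "fiber_blocks T = mat (dims T ! 0) (dims T ! 2)
     (\<lambda>(r, s). vec (dims T ! 1) (\<lambda>i. entry T [r, i, s]))"

definition tt_core :: "nat \<Rightarrow> real vec mat \<Rightarrow> tensor" where
  "tt_core d B = tensor_of [dim_row B, d, dim_col B] (\<lambda>is. B $$ (is ! 0, is ! 2) $ (is ! 1))"

lemma fiber_blocks_tt_core:
  assumes "B \<in> block_mats p q (carrier_vec d)"
  shows "fiber_blocks (tt_core d B) = B"
proof (rule eq_matI)
  fix r s assume rs: "r < dim_row B" "s < dim_col B"
  then have "B $$ (r, s) \<in> elements_mat B" unfolding elements_mat_def by fastforce
  with assms have "dim_vec (B $$ (r, s)) = d" by (auto simp: block_mats_def)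
  with rs show "fiber_blocks (tt_core d B) $$ (r, s) = B $$ (r, s)"
    by (intro eq_vecI) (auto simp: fiber_blocks_def tt_core_def indices_Cons)
qed (simp_all add: fiber_blocks_def tt_core_def)


section \<open>Frame matrices\<close>

text \<open>Here \<open>X m\<close> is the \<open>m\<close>-th core (\<open>1 \<le> m \<le> N\<close>). The scalar 1
  occurring for \<open>n = 1\<close> and \<open>n = N\<close> is kept as a tensor with a single mode of size
  \<open>R\<^sub>0 = R\<^sub>N = 1\<close>, so that it can be matricized.\<close>

definition cores_before :: "(nat \<Rightarrow> tensor) \<Rightarrow> nat \<Rightarrow> tensor" where
  "cores_before X n = (if n = 1 then tensor_of [1] (\<lambda>_. 1)
     else drop_first_mode (foldl (\<times>\<^sup>1) (X 1) (map X [2..<n])))"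

definition cores_after :: "(nat \<Rightarrow> tensor) \<Rightarrow> nat \<Rightarrow> nat \<Rightarrow> tensor" where
  "cores_after X N n = (if n = N then tensor_of [1] (\<lambda>_. 1)
     else drop_last_mode (foldl (\<times>\<^sup>1) (X (n + 1)) (map X [n + 2..<Suc N])))"

definition frame_matrix :: "(nat \<Rightarrow> tensor) \<Rightarrow> (nat \<Rightarrow> nat) \<Rightarrow> nat \<Rightarrow> nat \<Rightarrow> real mat" where
  "frame_matrix X I N n =
     (matricize n (cores_before X n))\<^sup>T \<otimes>\<^sub>K 1\<^sub>m (I n) \<otimes>\<^sub>K (matricize 1 (cores_after X N n))\<^sup>T"

end

theory Submission
  imports Defs
begin

text \<open>
  Replacing the \<open>n\<close>-th core of \<open>x\<close> by an arbitrary core \<open>W\<close> turns the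
  TT decomposition of \<open>x\<close> into one of \<open>X\<^sup>\<noteq>\<^sup>n w\<close>, so the left-hand side is the bilinear
  form \<open>(X\<^sup>\<noteq>\<^sup>n y)\<^sup>T A (X\<^sup>\<noteq>\<^sup>n w)\<close> of two TT vectors. Contracting such a form one mode at a
  time multiplies by one block row \<open>Z\<^sup>(\<^sup>m\<^sup>)\<close> after the other: by induction on \<open>m\<close>, the block of
  \<open>Z\<^sup>(\<^sup>1\<^sup>) |\<otimes>| \<dots> |\<otimes>| Z\<^sup>(\<^sup>m\<^sup>)\<close> at \<open>(r', r\<^sub>A, r)\<close> is the bilinear form of the first \<open>m\<close> cores with
  the last ranks fixed to \<open>r'\<close>, \<open>r\<^sub>A\<close>, \<open>r\<close>.
\<close>

section \<open>Sums and multi-indices\<close>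

text \<open>Splits a flat index into two digits, the second varying fastest. Sums over modes and
  over combined ranks are opened and closed with it.\<close>

lemma sum_lessThan_mult:
  fixes f :: "nat \<Rightarrow> 'a :: comm_monoid_add"
  shows "(\<Sum>t<m * n. f t) = (\<Sum>a<m. \<Sum>b<n. f (a * n + b))"
proof -
  have "sum f {a * n..<a * n + n} = (\<Sum>b<n. f (a * n + b))" for a
    using sum.shift_bounds_nat_ivl[of f 0 "a * n" n]
    by (simp add: lessThan_atLeast0 add.commute)
  then show ?thesis by (simp add: sum.nat_group[symmetric])
qed

lemma mult_add_less:
  fixes a b m n :: nat
  assumes "a < m" "b < n"
  shows "a * n + b < m * n"
proof -
  have "a * n + b < Suc a * n" using assms by simp
  also have "\<dots> \<le> m * n" using assms by (intro mult_le_mono1) simp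
  finally show ?thesis .
qed

text \<open>Both sides read off the same digit of \<open>i = (a * q + b) * d + c\<close> with
  \<open>b < q\<close> and \<open>c < d\<close>: first \<open>a\<close>, then \<open>b\<close>, then
  \<open>c\<close>. They let the last digit be removed before or after splitting at
  \<open>q * d\<close>.\<close>

lemma div_mod_mult_nat:
  fixes i d q :: nat
  shows "i div d div q = i div (q * d)" "i div d mod q = i mod (q * d) div d"
    "i mod (q * d) mod d = i mod d"
proof -
  show "i div d div q = i div (q * d)" by (simp add: div_mult2_eq[symmetric] mult.commute)
  show "i mod (q * d) mod d = i mod d" by (simp add: mod_mod_cancel)
  show "i div d mod q = i mod (q * d) div d"
    by (cases "d = 0") (simp_all add: mod_mult2_eq mult.commute[of q])
qed

lemma prod_list_map_upt: "prod_list (map f [a..<Suc b]) = (\<Prod>m=a..b. f m :: nat)"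
  using prod.distinct_set_conv_list[of "[a..<Suc b]" f]
  by (simp add: atLeastLessThanSuc_atLeastAtMost del: upt_Suc)

lemma indices_append:
  "is @ js \<in> indices (ds @ es) \<longleftrightarrow> is \<in> indices ds \<and> js \<in> indices es"
  if "length is = length ds"
  using that by (simp add: indices_def list_all2_append)

lemma length_indices: "is \<in> indices ds \<Longrightarrow> length is = length ds"
  by (simp add: indices_def list_all2_lengthD)

text \<open>\<open>multi_index\<close> recurses on the first index, whereas trains grow at the last
  core; this is the Horner recursion from the other end.\<close>

lemma multi_index_snoc:
  "length is = length ds \<Longrightarrow> multi_index (ds @ [d]) (is @ [i]) = multi_index ds is * d + i"
  by (induction "is" ds rule: list_induct2) (simp_all add: algebra_simps)

section \<open>Entries of tensor trains\<close>

text \<open>The entry of the train of cores \<open>p + 1, \<dots>, p + k\<close> at the flat index \<open>i\<close> and the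
  boundary ranks \<open>r\<close>, \<open>s\<close>; the empty train is the identity matrix.\<close>

fun tt_entry :: "(nat \<Rightarrow> tensor) \<Rightarrow> nat \<Rightarrow> nat \<Rightarrow> nat \<Rightarrow> nat \<Rightarrow> nat \<Rightarrow> real" where
  "tt_entry X p 0 i r s = (if r = s then 1 else 0)"
| "tt_entry X p (Suc k) i r s = (let T = X (Suc (p + k)); d = dims T ! 1 in
     \<Sum>t<dims T ! 0. tt_entry X p k (i div d) r t * entry T [t, i mod d, s])"

text \<open>Only the cores \<open>p + 1, ..., p + k\<close> are read, so a train on either side of
  core \<open>n\<close> does not notice that core \<open>n\<close> is replaced.\<close>

lemma tt_entry_cong:
  "(\<And>m. p < m \<Longrightarrow> m \<le> p + k \<Longrightarrow> X m = Y m) \<Longrightarrow> tt_entry X p k i r s = tt_entry Y p k i r s"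
  by (induction k arbitrary: i s) (simp_all add: Let_def)

text \<open>Only sizes are prescribed, so the predicate survives replacing a core by any tensor of
  the same sizes.\<close>

definition tt_cores :: "(nat \<Rightarrow> nat) \<Rightarrow> (nat \<Rightarrow> nat) \<Rightarrow> nat \<Rightarrow> (nat \<Rightarrow> tensor) \<Rightarrow> bool" where
  "tt_cores I R N X \<longleftrightarrow> (\<forall>m\<in>{1..N}. dims (X m) = [R (m - 1), I m, R m])"

lemma dims_tt_cores:
  "tt_cores I R N X \<Longrightarrow> m < N \<Longrightarrow> dims (X (Suc m)) = [R m, I (Suc m), R (Suc m)]"
  by (auto simp: tt_cores_def)

lemma tt_entry_Suc:
  "tt_cores I R N X \<Longrightarrow> p + k < N \<Longrightarrow> tt_entry X p (Suc k) i r s =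
    (\<Sum>t<R (p + k). tt_entry X p k (i div I (Suc (p + k))) r t
       * entry (X (Suc (p + k))) [t, i mod I (Suc (p + k)), s])"
  using dims_tt_cores[of I R N X "p + k"] by (simp add: Let_def)

lemma tt_entry_1:
  assumes "tt_cores I R N X" "p < N" "r < R p" "i < I (Suc p)"
  shows "tt_entry X p 1 i r s = entry (X (Suc p)) [r, i, s]"
proof -
  have "tt_entry X p 1 i r s = (\<Sum>t<R p. (if r = t then 1 else 0) * entry (X (Suc p)) [t, i, s])"
    using assms dims_tt_cores[of I R N X p] by (simp add: Let_def)
  also have "\<dots> = (\<Sum>t<R p. if r = t then entry (X (Suc p)) [t, i, s] else 0)"
    by (intro sum.cong) auto
  also have "\<dots> = entry (X (Suc p)) [r, i, s]" using assms by simp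
  finally show ?thesis .
qed

text \<open>A train with fixed mode indices is a product of matrices, and this is associativity at
  the cut after core \<open>p + k\<close>: the quotient of \<open>i\<close> indexes the left half,
  the remainder the right half. The bound on \<open>s\<close> serves the case \<open>l = 0\<close>,
  where the right half is the identity and the sum must reach \<open>t = s\<close>.\<close>

lemma tt_entry_add:
  assumes X: "tt_cores I R N X" and "p + k + l \<le> N" "s < R (p + k + l)"
  shows "tt_entry X p (k + l) i r s = (\<Sum>t<R (p + k).
    tt_entry X p k (i div (\<Prod>m=Suc (p + k)..p + k + l. I m)) r t
    * tt_entry X (p + k) l (i mod (\<Prod>m=Suc (p + k)..p + k + l. I m)) t s)"
  using assms(2,3)
proof (induction l arbitrary: i s)
  case 0
  have "(\<Sum>t<R (p + k). tt_entry X p k i r t * (if t = s then 1 else 0))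
    = (\<Sum>t<R (p + k). if t = s then tt_entry X p k i r t else 0)" by (intro sum.cong) auto
  with 0 show ?case by simp
next
  case (Suc l)
  define q where "q = p + k"
  define Q where "Q = (\<Prod>m=Suc q..q + l. I m)"
  define d where "d = I (Suc (q + l))"
  have Qd: "(\<Prod>m=Suc q..q + Suc l. I m) = Q * d" by (simp add: Q_def d_def)
  let ?e = "\<lambda>t. entry (X (Suc (q + l))) [t, i mod d, s]"
  have "tt_entry X p (k + Suc l) i r s = (\<Sum>u<R (q + l). tt_entry X p (k + l) (i div d) r u * ?e u)"
    using tt_entry_Suc[OF X, of p "k + l" i r s] Suc.prems by (simp add: q_def d_def add.assoc)
  \<comment> \<open>Splitting \<open>i div d\<close> at \<open>Q\<close> gives the quotient of
    \<open>i\<close> by \<open>Q * d\<close> and the remainder with its last digit removed.\<close>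
  also have "\<dots> = (\<Sum>u<R (q + l). (\<Sum>t<R q. tt_entry X p k (i div (Q * d)) r t
      * tt_entry X q l (i mod (Q * d) div d) t u) * ?e u)"
    using Suc.prems Suc.IH by (intro sum.cong refl) (simp add: q_def Q_def div_mod_mult_nat)
  also have "\<dots> = (\<Sum>t<R q. tt_entry X p k (i div (Q * d)) r t
      * (\<Sum>u<R (q + l). tt_entry X q l (i mod (Q * d) div d) t u * ?e u))"
    unfolding sum_distrib_left sum_distrib_right by (subst sum.swap) (simp add: mult_ac)
  also have "\<dots> = (\<Sum>t<R q. tt_entry X p k (i div (Q * d)) r t
      * tt_entry X q (Suc l) (i mod (Q * d)) t s)"
    using Suc.prems tt_entry_Suc[OF X, of q l "i mod (Q * d)" _ s]
    by (simp add: q_def d_def div_mod_mult_nat)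
  finally show ?case unfolding q_def[symmetric] Qd .
qed

text \<open>Contraction from the left appends one core at a time, exactly as \<open>tt_entry\<close>
  recurses. \<open>F k\<close> contains \<open>k + 1\<close> cores because the fold starts from a
  first core, and both boundary ranks stay as outer modes.\<close>

lemma contract_cores:
  assumes X: "tt_cores I R N X" and "p + Suc k \<le> N"
  defines "F \<equiv> \<lambda>k. foldl (\<times>\<^sup>1) (X (Suc p)) (map X [p + 2..<Suc (p + Suc k)])"
    and "Is \<equiv> \<lambda>k. map I [Suc p..<Suc (p + Suc k)]"
  shows "dims (F k) = R p # Is k @ [R (p + Suc k)]"
    and "r < R p \<Longrightarrow> is \<in> indices (Is k) \<Longrightarrow> s < R (p + Suc k) \<Longrightarrow>
      entry (F k) (r # is @ [s]) = tt_entry X p (Suc k) (multi_index (Is k) is) r s"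
proof -
  have "dims (F k) = R p # Is k @ [R (p + Suc k)] \<and>
    (\<forall>r is s. r < R p \<longrightarrow> is \<in> indices (Is k) \<longrightarrow> s < R (p + Suc k) \<longrightarrow>
      entry (F k) (r # is @ [s]) = tt_entry X p (Suc k) (multi_index (Is k) is) r s)"
    using assms(2)
  proof (induction k)
    case 0
    then show ?case
      using dims_tt_cores[OF X, of p] tt_entry_1[OF X, of p]
      by (auto simp: F_def Is_def indices_Cons simp del: tt_entry.simps)
  next
    case (Suc k)
    let ?m = "p + Suc k"
    have FS: "F (Suc k) = F k \<times>\<^sup>1 X (Suc ?m)" by (simp add: F_def)
    have IsS: "Is (Suc k) = Is k @ [I (Suc ?m)]" by (simp add: Is_def)
    have IH: "dims (F k) = R p # Is k @ [R ?m]"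
      "\<And>r is s. r < R p \<Longrightarrow> is \<in> indices (Is k) \<Longrightarrow> s < R ?m \<Longrightarrow>
        entry (F k) (r # is @ [s]) = tt_entry X p (Suc k) (multi_index (Is k) is) r s"
      using Suc by auto
    have dX: "dims (X (Suc (Suc (p + k)))) = [R ?m, I (Suc ?m), R (Suc ?m)]"
      using dims_tt_cores[OF X, of ?m] Suc.prems by simp
    have dF: "dims (F (Suc k)) = R p # Is (Suc k) @ [R (Suc ?m)]"
      by (simp add: FS contract_def Let_def IH dX IsS butlast_append)
    have "entry (F (Suc k)) (r # is @ [s]) = tt_entry X p (Suc (Suc k)) (multi_index (Is (Suc k)) is) r s"
      if r: "r < R p" and "is": "is \<in> indices (Is (Suc k))" and s: "s < R (Suc ?m)" for r "is" s
    proof -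
      obtain js i where js: "is = js @ [i]" "js \<in> indices (Is k)" "i < I (Suc ?m)"
      proof (cases "is" rule: rev_cases)
        case Nil
        with "is" show ?thesis by (auto simp: indices_def IsS)
      next
        case (snoc js i)
        with length_indices[OF "is"] have "length js = length (Is k)" by (simp add: IsS)
        with "is" snoc that show ?thesis by (auto simp: IsS indices_append indices_Cons)
      qed
      have len: "length js = length (Is k)" using js by (simp add: length_indices)
      \<comment> \<open>Tensor entries are given by their defining function only inside the index
        range, so membership must be known before the contraction unfolds.\<close>
      have in_ind: "r # js @ [i, s] \<in> indices (R p # Is k @ [I (Suc ?m), R (Suc ?m)])"
        using r js s len by (simp add: indices_Cons indices_append)
      have "entry (F (Suc k)) (r # is @ [s]) =
        (\<Sum>t<R ?m. entry (F k) (r # js @ [t]) * entry (X (Suc ?m)) [t, i, s])"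
        using in_ind by (simp add: FS contract_def Let_def IH dX js butlast_append len)
      also have "\<dots> = (\<Sum>t<R ?m. tt_entry X p (Suc k) (multi_index (Is k) js) r t
          * entry (X (Suc ?m)) [t, i, s])"
        using IH(2)[OF r js(2)] by simp
      also have "\<dots> = tt_entry X p (Suc (Suc k)) (multi_index (Is (Suc k)) is) r s"
        using tt_entry_Suc[OF X, of p "Suc k"] Suc.prems js(3) len
        by (simp add: IsS js multi_index_snoc del: tt_entry.simps)
      finally show ?thesis .
    qed
    with dF show ?case by simp
  qed
  then show "dims (F k) = R p # Is k @ [R (p + Suc k)]"
    and "r < R p \<Longrightarrow> is \<in> indices (Is k) \<Longrightarrow> s < R (p + Suc k) \<Longrightarrow>
      entry (F k) (r # is @ [s]) = tt_entry X p (Suc k) (multi_index (Is k) is) r s"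
    by auto
qed

section \<open>Frame matrices\<close>

text \<open>The left boundary mode has size \<open>R 0 = 1\<close> and is dropped at index 0, whence
  the left rank 0 in \<open>tt_entry\<close>. The free rank is mode \<open>n\<close>, the last one,
  so the column index is the flat index of the first \<open>n - 1\<close> modes.\<close>

lemma matricize_cores_before:
  assumes X: "tt_cores I R N X" and n: "1 \<le> n" "n \<le> N" and "R 0 = 1"
  defines "M \<equiv> matricize n (cores_before X n)" and "P \<equiv> \<Prod>m=1..n - 1. I m"
  shows "M \<in> carrier_mat (R (n - 1)) P"
    and "r < R (n - 1) \<Longrightarrow> i < P \<Longrightarrow> M $$ (r, i) = tt_entry X 0 (n - 1) i 0 r"
proof -
  have "M \<in> carrier_mat (R (n - 1)) P \<and>
    (\<forall>r i. r < R (n - 1) \<longrightarrow> i < P \<longrightarrow> M $$ (r, i) = tt_entry X 0 (n - 1) i 0 r)"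
  proof (cases "n = 1")
    case True
    \<comment> \<open>The scalar 1 agrees with the empty train, which is the identity at the only
      rank 0, and \<open>P\<close> is an empty product.\<close>
    then show ?thesis using assms(4)
      by (auto simp: M_def P_def cores_before_def matricize_def drop_mode_def insert_mode_def indices_Cons)
  next
    case False
    \<comment> \<open>There are \<open>n - 1 = Suc k\<close> cores before core \<open>n\<close>, the
      form in which \<open>contract_cores\<close> counts them.\<close>
    then obtain k where k: "n = Suc (Suc k)" using n by (cases n; cases "n - 1") auto
    define Is where "Is = map I [1..<n]"
    define T where "T = cores_before X n"
    define F where "F = foldl (\<times>\<^sup>1) (X 1) (map X [2..<n])"
    have len: "length Is = n - 1" by (simp add: Is_def)
    have P: "P = prod_list Is" using prod_list_map_upt[of I 1 "n - 1"] n by (simp add: P_def Is_def)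
    have dF: "dims F = 1 # Is @ [R (n - 1)]"
      using contract_cores(1)[OF X, of 0 k] n assms(4) unfolding F_def Is_def k
      by (simp add: numeral_2_eq_2 del: upt_Suc)
    have eF: "entry F (0 # is @ [r]) = tt_entry X 0 (n - 1) (multi_index Is is) 0 r"
      if "is \<in> indices Is" "r < R (n - 1)" for "is" r
      using contract_cores(2)[OF X, of 0 k 0 "is" r] n assms(4) that unfolding F_def Is_def k
      by (simp add: numeral_2_eq_2 del: upt_Suc tt_entry.simps)
    have T: "T = drop_first_mode F" using False by (simp add: T_def cores_before_def F_def)
    have dT: "dims T = Is @ [R (n - 1)]" by (simp add: T drop_first_mode_def dF)
    have eT: "entry T (is @ [r]) = tt_entry X 0 (n - 1) (multi_index Is is) 0 r"
      if "is \<in> indices Is" "r < R (n - 1)" for "is" r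
      using that eF by (simp add: T drop_first_mode_def dF indices_append length_indices indices_Cons)
    have es: "drop_mode n (Is @ [R (n - Suc 0)]) = Is" using n len by (simp add: drop_mode_def)
    have "M $$ (r, i) = tt_entry X 0 (n - 1) i 0 r" if "r < R (n - 1)" "i < P" for r i
    proof -
      define js where "js = multi_index_inv Is i"
      have js: "js \<in> indices Is" "multi_index Is js = i"
        using that P by (auto simp: js_def multi_index_inv_in_indices multi_index_multi_index_inv)
      \<comment> \<open>\<open>js\<close> has length \<open>n - 1\<close>, so inserting at mode
        \<open>n\<close> appends.\<close>
      have "insert_mode n r js = js @ [r]"
        using length_indices[OF js(1)] len by (simp add: insert_mode_def)
      then show ?thesis using that P js eT[OF js(1)] len
        by (simp add: M_def matricize_def es T_def[symmetric] Let_def js_def[symmetric] dT nth_append)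
    qed
    moreover have "M \<in> carrier_mat (R (n - 1)) P"
      by (simp add: M_def matricize_def T_def[symmetric] es Let_def P dT nth_append len)
    ultimately show ?thesis by blast
  qed
  then show "M \<in> carrier_mat (R (n - 1)) P"
    and "r < R (n - 1) \<Longrightarrow> i < P \<Longrightarrow> M $$ (r, i) = tt_entry X 0 (n - 1) i 0 r" by auto
qed

text \<open>Mirror image of \<open>matricize_cores_before\<close>: the right boundary mode of size
  \<open>R N = 1\<close> is dropped at index 0, and the free rank is mode 1.\<close>

lemma matricize_cores_after:
  assumes X: "tt_cores I R N X" and n: "n \<le> N" and "R N = 1"
  defines "M \<equiv> matricize 1 (cores_after X N n)" and "Q \<equiv> \<Prod>m=Suc n..N. I m"
  shows "M \<in> carrier_mat (R n) Q"
    and "r < R n \<Longrightarrow> i < Q \<Longrightarrow> M $$ (r, i) = tt_entry X n (N - n) i r 0"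
proof -
  have "M \<in> carrier_mat (R n) Q \<and>
    (\<forall>r i. r < R n \<longrightarrow> i < Q \<longrightarrow> M $$ (r, i) = tt_entry X n (N - n) i r 0)"
  proof (cases "n = N")
    case True
    then show ?thesis using assms(3)
      by (auto simp: M_def Q_def cores_after_def matricize_def drop_mode_def insert_mode_def indices_Cons)
  next
    case False
    with n obtain k where k: "N = n + Suc k" by (metis less_iff_Suc_add add_Suc_right le_neq_implies_less)
    define Is where "Is = map I [Suc n..<Suc N]"
    define T where "T = cores_after X N n"
    define F where "F = foldl (\<times>\<^sup>1) (X (n + 1)) (map X [n + 2..<Suc N])"
    have Q: "Q = prod_list Is" using prod_list_map_upt[of I "Suc n" N] by (simp add: Q_def Is_def)
    have dF: "dims F = R n # Is @ [1]"
      using contract_cores(1)[OF X, of n k] assms(3) unfolding F_def Is_def k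
      by (simp del: upt_Suc)
    have eF: "entry F (r # is @ [0]) = tt_entry X n (N - n) (multi_index Is is) r 0"
      if "is \<in> indices Is" "r < R n" for "is" r
      using contract_cores(2)[OF X, of n k r "is" 0] assms(3) that unfolding F_def Is_def k
      by (simp del: upt_Suc tt_entry.simps)
    have T: "T = drop_last_mode F" using False by (simp add: T_def cores_after_def F_def)
    have dT: "dims T = R n # Is" by (simp add: T drop_last_mode_def dF)
    have eT: "entry T (r # is) = tt_entry X n (N - n) (multi_index Is is) r 0"
      if "is \<in> indices Is" "r < R n" for "is" r
      using that eF by (simp add: T drop_last_mode_def dF indices_Cons)
    have es: "drop_mode (Suc 0) (R n # Is) = Is" by (simp add: drop_mode_def)
    have "M $$ (r, i) = tt_entry X n (N - n) i r 0" if "r < R n" "i < Q" for r i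
    proof -
      define js where "js = multi_index_inv Is i"
      have js: "js \<in> indices Is" "multi_index Is js = i"
        using that Q by (auto simp: js_def multi_index_inv_in_indices multi_index_multi_index_inv)
      have "insert_mode (Suc 0) r js = r # js" by (simp add: insert_mode_def)
      then show ?thesis using that Q js eT[OF js(1)]
        by (simp add: M_def matricize_def es T_def[symmetric] Let_def js_def[symmetric] dT)
    qed
    moreover have "M \<in> carrier_mat (R n) Q"
      using es by (simp add: M_def matricize_def T_def[symmetric] Let_def Q dT)
    ultimately show ?thesis by blast
  qed
  then show "M \<in> carrier_mat (R n) Q"
    and "r < R n \<Longrightarrow> i < Q \<Longrightarrow> M $$ (r, i) = tt_entry X n (N - n) i r 0" by auto
qed

section \<open>Kronecker products and the action of the frame matrix\<close>

lemma kronecker_index: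
  assumes "A \<in> carrier_mat a b" "B \<in> carrier_mat c d" "i < a * c" "j < b * d"
  shows "(A \<otimes>\<^sub>K B) $$ (i, j) = A $$ (i div c, j div d) * B $$ (i mod c, j mod d)"
  using assms(3,4) by (simp add: kronecker_def carrier_matD[OF assms(1)] carrier_matD[OF assms(2)])

lemma kronecker_carrier:
  "A \<in> carrier_mat a b \<Longrightarrow> B \<in> carrier_mat c d \<Longrightarrow> A \<otimes>\<^sub>K B \<in> carrier_mat (a * c) (b * d)"
  by (rule carrier_matI) (simp_all only: kronecker_def dim_row_mat dim_col_mat carrier_matD)

lemma prod_split_at:
  fixes I :: "nat \<Rightarrow> nat"
  assumes "1 \<le> n" "n \<le> N"
  shows "(\<Prod>m=1..N. I m) = (\<Prod>m=1..n - 1. I m) * I n * (\<Prod>m=Suc n..N. I m)"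
proof -
  have "{1..N} = insert n ({1..n - 1} \<union> {Suc n..N})" using assms by auto
  then have "(\<Prod>m=1..N. I m) = I n * (\<Prod>m\<in>{1..n - 1} \<union> {Suc n..N}. I m)"
    by (simp only: prod.insert) (use assms in auto)
  also have "(\<Prod>m\<in>{1..n - 1} \<union> {Suc n..N}. I m) = (\<Prod>m=1..n - 1. I m) * (\<Prod>m=Suc n..N. I m)"
    by (intro prod.union_disjoint) auto
  finally show ?thesis by simp
qed

lemma frame_matrix_carrier:
  assumes X: "tt_cores I R N X" and n: "1 \<le> n" "n \<le> N" and R: "R 0 = 1" "R N = 1"
  shows "frame_matrix X I N n \<in> carrier_mat (\<Prod>m=1..N. I m) (R (n - 1) * I n * R n)"
  unfolding frame_matrix_def prod_split_at[OF n]
  by (intro kronecker_carrier one_carrier_mat transpose_carrier_mat[THEN iffD2]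
      matricize_cores_before(1)[OF X n R(1)] matricize_cores_after(1)[OF X n(2) R(2)])

text \<open>The two outer Kronecker factors are the trains left and right of core \<open>n\<close>,
  and the identity factor selects the index of mode \<open>n\<close>. Summing over the columns
  therefore inserts \<open>T\<close> between the two trains as core \<open>n\<close>.\<close>

lemma frame_matrix_mult_vectorize:
  assumes X: "tt_cores I R N X" and n: "1 \<le> n" "n \<le> N" and R: "R 0 = 1" "R N = 1"
    and T: "dims T = [R (n - 1), I n, R n]" and i: "i < (\<Prod>m=1..N. I m)"
  shows "(frame_matrix X I N n *\<^sub>v vectorize T) $ i = tt_entry (X(n := T)) 0 N i 0 0"
proof -
  define P where "P = (\<Prod>m=1..n - 1. I m)"
  define Q where "Q = (\<Prod>m=Suc n..N. I m)"
  define d where "d = I n"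
  define M where "M = matricize n (cores_before X n)"
  define L where "L = matricize 1 (cores_after X N n)"
  let ?F = "frame_matrix X I N n" and ?X = "X(n := T)"
  have F: "?F = M\<^sup>T \<otimes>\<^sub>K 1\<^sub>m d \<otimes>\<^sub>K L\<^sup>T" by (simp add: frame_matrix_def M_def L_def d_def)
  have M: "M \<in> carrier_mat (R (n - 1)) P"
    "\<And>r i. r < R (n - 1) \<Longrightarrow> i < P \<Longrightarrow> M $$ (r, i) = tt_entry X 0 (n - 1) i 0 r"
    unfolding M_def P_def using matricize_cores_before[OF X n R(1)] by blast+
  have L: "L \<in> carrier_mat (R n) Q"
    "\<And>r i. r < R n \<Longrightarrow> i < Q \<Longrightarrow> L $$ (r, i) = tt_entry X n (N - n) i r 0"
    unfolding L_def Q_def using matricize_cores_after[OF X n(2) R(2)] by blast+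
  have iPdQ: "i < P * d * Q" using i unfolding prod_split_at[OF n] P_def Q_def d_def .
  \<comment> \<open>A product that exceeds some index has no zero factor.\<close>
  then have pos: "0 < d" "0 < Q" by (auto intro: Nat.gr0I)
  \<comment> \<open>The digits of the row index: \<open>a\<close> for the modes before
    \<open>n\<close>, \<open>b\<close> for mode \<open>n\<close>, \<open>c\<close> for the modes
    after \<open>n\<close>.\<close>
  define a b c where "a = i div Q div d" and "b = i div Q mod d" and "c = i mod Q"
  have "i div Q < P * d" using iPdQ by (simp add: less_mult_imp_div_less)
  then have abc: "a < P" "b < d" "c < Q" "i div Q < P * d"
    using pos by (auto simp: a_def b_def c_def less_mult_imp_div_less)
  have MK: "M\<^sup>T \<otimes>\<^sub>K 1\<^sub>m d \<in> carrier_mat (P * d) (R (n - 1) * d)"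
    using M(1) by (intro kronecker_carrier) auto
  have entryF: "?F $$ (i, (r * d + e) * R n + s) =
      (if b = e then tt_entry X 0 (n - 1) a 0 r * tt_entry X n (N - n) c s 0 else 0)"
    if "r < R (n - 1)" "e < d" "s < R n" for r e s
  proof -
    have j: "r * d + e < R (n - 1) * d" "(r * d + e) * R n + s < R (n - 1) * d * R n"
      using that by (auto intro: mult_add_less)
    have "?F $$ (i, (r * d + e) * R n + s)
        = (M\<^sup>T \<otimes>\<^sub>K 1\<^sub>m d) $$ (i div Q, r * d + e) * L\<^sup>T $$ (c, s)"
      unfolding F using kronecker_index[OF MK _ iPdQ j(2), of "L\<^sup>T"] L(1) that by (simp add: c_def)
    also have "(M\<^sup>T \<otimes>\<^sub>K 1\<^sub>m d) $$ (i div Q, r * d + e) = M\<^sup>T $$ (a, r) * 1\<^sub>m d $$ (b, e)"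
      using kronecker_index[of "M\<^sup>T" P "R (n - 1)" "1\<^sub>m d" d d, OF _ _ abc(4) j(1)] M(1) that
      by (simp add: a_def b_def)
    finally show ?thesis using that M L abc by simp
  qed
  have vT: "vectorize T $ ((r * d + e) * R n + s) = entry T [r, e, s]"
    if "r < R (n - 1)" "e < d" "s < R n" for r e s
    using vectorize_index[of "[r, e, s]" T] that
    by (simp add: T indices_Cons d_def algebra_simps)
  have X': "tt_cores I R N ?X" using X T by (auto simp: tt_cores_def)
  have cF: "?F \<in> carrier_mat (P * d * Q) (R (n - 1) * d * R n)"
    using frame_matrix_carrier[OF X n R] unfolding prod_split_at[OF n] P_def Q_def d_def .
  have dv: "dim_vec (vectorize T) = R (n - 1) * d * R n" by (simp add: vectorize_def T d_def)
  have "(?F *\<^sub>v vectorize T) $ i = (\<Sum>j<R (n - 1) * d * R n. ?F $$ (i, j) * vectorize T $ j)"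
    using cF iPdQ dv by (simp add: scalar_prod_def lessThan_atLeast0)
  also have "\<dots> = (\<Sum>r<R (n - 1). \<Sum>e<d. \<Sum>s<R n.
      ?F $$ (i, (r * d + e) * R n + s) * vectorize T $ ((r * d + e) * R n + s))"
    by (simp only: sum_lessThan_mult)
  also have "\<dots> = (\<Sum>r<R (n - 1). \<Sum>e<d. if b = e then
      (\<Sum>s<R n. tt_entry X 0 (n - 1) a 0 r * tt_entry X n (N - n) c s 0 * entry T [r, e, s]) else 0)"
    by (intro sum.cong refl) (simp add: entryF vT)
  \<comment> \<open>The identity factor leaves only \<open>e = b\<close>, which lies in range
    because \<open>b < d\<close>.\<close>
  also have "\<dots> = (\<Sum>r<R (n - 1). \<Sum>s<R n.
      tt_entry X 0 (n - 1) a 0 r * tt_entry X n (N - n) c s 0 * entry T [r, b, s])"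
    using abc by simp
  also have "\<dots> = (\<Sum>s<R n. (\<Sum>r<R (n - 1). tt_entry X 0 (n - 1) a 0 r * entry T [r, b, s])
      * tt_entry X n (N - n) c s 0)"
    by (subst sum.swap) (simp add: sum_distrib_left mult_ac)
  \<comment> \<open>The sum over \<open>r\<close> is the recursion step of \<open>tt_entry\<close>
    at core \<open>n\<close>, now \<open>T\<close>; the outer trains do not contain core
    \<open>n\<close>, so \<open>X\<close> may be updated in them too.\<close>
  also have "\<dots> = (\<Sum>s<R n. tt_entry ?X 0 n (i div Q) 0 s * tt_entry ?X n (N - n) c s 0)"
  proof (intro sum.cong refl arg_cong2[where f = "(*)"])
    fix s
    have "tt_entry X 0 (n - 1) a 0 r = tt_entry ?X 0 (n - 1) a 0 r" for r
      using n by (intro tt_entry_cong) auto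
    then show "(\<Sum>r<R (n - 1). tt_entry X 0 (n - 1) a 0 r * entry T [r, b, s])
        = tt_entry ?X 0 n (i div Q) 0 s"
      using tt_entry_Suc[OF X', of 0 "n - 1" "i div Q" 0 s] n
      by (simp add: a_def b_def d_def)
    show "tt_entry X n (N - n) c s 0 = tt_entry ?X n (N - n) c s 0"
      by (intro tt_entry_cong) auto
  qed
  also have "\<dots> = tt_entry ?X 0 N i 0 0"
    using tt_entry_add[OF X', of 0 n "N - n" 0 i 0] n R by (simp add: Q_def c_def)
  finally show ?thesis .
qed

section \<open>Strong Kronecker products\<close>

lemma block_mats_iff:
  "B \<in> block_mats p q S \<longleftrightarrow> B \<in> carrier_mat p q \<and> (\<forall>r<p. \<forall>s<q. B $$ (r, s) \<in> S)"
  unfolding block_mats_def elements_mat_def by (auto simp: UN_subset_iff image_subset_iff)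

lemma block_mats_dim:
  "B \<in> block_mats p q S \<Longrightarrow> dim_row B = p" "B \<in> block_mats p q S \<Longrightarrow> dim_col B = q"
  by (auto simp: block_mats_def)

text \<open>The bound \<open>0 < q\<close> provides the summand with index 0, from which the block
  size of the product is read.\<close>

lemma strong_kronecker:
  assumes B: "B \<in> block_mats p q (carrier_mat a b)" and C: "C \<in> block_mats q s (carrier_mat c d)"
    and q: "0 < q"
  shows strong_kronecker_block_mats:
      "B |\<otimes>| C \<in> block_mats p s (carrier_mat (a * c) (b * d))"
    and strong_kronecker_index: "r < p \<Longrightarrow> t < s \<Longrightarrow> i < a * c \<Longrightarrow> j < b * d \<Longrightarrow>
      (B |\<otimes>| C) $$ (r, t) $$ (i, j) =
        (\<Sum>u<q. B $$ (r, u) $$ (i div c, j div d) * C $$ (u, t) $$ (i mod c, j mod d))"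
proof -
  have K: "B $$ (r, u) \<otimes>\<^sub>K C $$ (u, t) \<in> carrier_mat (a * c) (b * d)"
    if "r < p" "u < q" "t < s" for r u t
    using that B C by (intro kronecker_carrier) (auto simp: block_mats_iff)
  show "B |\<otimes>| C \<in> block_mats p s (carrier_mat (a * c) (b * d))"
    using B C carrier_matD[OF K[OF _ q]]
    by (auto simp: block_mats_iff strong_kronecker_def Let_def intro!: carrier_matI)
  show "(B |\<otimes>| C) $$ (r, t) $$ (i, j) =
        (\<Sum>u<q. B $$ (r, u) $$ (i div c, j div d) * C $$ (u, t) $$ (i mod c, j mod d))"
    if *: "r < p" "t < s" "i < a * c" "j < b * d"
  proof -
    have "dim_row B = p" "dim_col B = q" "dim_col C = s" using B C by (auto simp: block_mats_iff)
    then have "(B |\<otimes>| C) $$ (r, t) $$ (i, j) = (\<Sum>u<q. (B $$ (r, u) \<otimes>\<^sub>K C $$ (u, t)) $$ (i, j))"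
      using K[of r 0 t] q * by (simp add: strong_kronecker_def Let_def)
    also have "\<dots> = (\<Sum>u<q. B $$ (r, u) $$ (i div c, j div d) * C $$ (u, t) $$ (i mod c, j mod d))"
      using B C * by (intro sum.cong refl kronecker_index) (auto simp: block_mats_iff)
    finally show ?thesis .
  qed
qed

lemma strong_kronecker_chain_1: "strong_kronecker_chain B 1 = B 1"
  by (simp add: strong_kronecker_chain_def)

lemma strong_kronecker_chain_Suc:
  "1 \<le> m \<Longrightarrow> strong_kronecker_chain B (Suc m) = strong_kronecker_chain B m |\<otimes>| B (Suc m)"
  by (simp add: strong_kronecker_chain_def)

lemma strong_kronecker_chain_block_mats:
  assumes "\<And>m. m \<in> {1..N} \<Longrightarrow> B m \<in> block_mats (R (m - 1)) (R m) (carrier_mat (I m) (J m))"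
    and "\<And>m. m \<in> {0..N} \<Longrightarrow> 0 < R m" and "1 \<le> m" "m \<le> N"
  shows "strong_kronecker_chain B m \<in>
    block_mats (R 0) (R m) (carrier_mat (\<Prod>k=1..m. I k) (\<Prod>k=1..m. J k))"
  using assms(3,4)
proof (induction m rule: nat_induct_at_least)
  case base
  then show ?case using assms(1)[of 1] by (simp add: strong_kronecker_chain_1[simplified])
next
  case (Suc m)
  with assms(1)[of "Suc m"] assms(2)[of m]
  show ?case using strong_kronecker_block_mats[of "strong_kronecker_chain B m" "R 0" "R m"
      "\<Prod>k=1..m. I k" "\<Prod>k=1..m. J k" "B (Suc m)" "R (Suc m)" "I (Suc m)" "J (Suc m)"]
    by (simp add: strong_kronecker_chain_Suc)
qed

section \<open>Contracted products of blocks\<close>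

lemma contract_vec_mat_vec:
  assumes "v \<in> carrier_vec d" "M \<in> carrier_mat d e" "w \<in> carrier_vec e"
  shows "dims (tensor_of_vec v \<times>\<^sup>1 tensor_of_mat M \<times>\<^sup>1 tensor_of_vec w) = []"
    and "entry (tensor_of_vec v \<times>\<^sup>1 tensor_of_mat M \<times>\<^sup>1 tensor_of_vec w) [] =
      (\<Sum>i<d. \<Sum>j<e. v $ i * M $$ (i, j) * w $ j)"
proof -
  \<comment> \<open>The product associates to the left: first the row vector \<open>v^T M\<close> as
    a tensor of order 1, then its inner product with \<open>w\<close>, of order 0 and with the empty
    list as only index.\<close>
  have vM: "tensor_of_vec v \<times>\<^sup>1 tensor_of_mat M
      = tensor_of [e] (\<lambda>is. \<Sum>i<d. v $ i * M $$ (i, is ! 0))"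
    using assms
    by (intro tensor_eqI) (auto simp: contract_def tensor_of_vec_def tensor_of_mat_def indices_Cons Let_def)
  show "dims (tensor_of_vec v \<times>\<^sup>1 tensor_of_mat M \<times>\<^sup>1 tensor_of_vec w) = []"
    unfolding vM by (simp add: contract_def tensor_of_vec_def)
  have "entry (tensor_of_vec v \<times>\<^sup>1 tensor_of_mat M \<times>\<^sup>1 tensor_of_vec w) [] =
      (\<Sum>j<e. (\<Sum>i<d. v $ i * M $$ (i, j)) * w $ j)"
    unfolding vM using assms by (simp add: contract_def tensor_of_vec_def indices_Cons)
  then show "entry (tensor_of_vec v \<times>\<^sup>1 tensor_of_mat M \<times>\<^sup>1 tensor_of_vec w) [] =
      (\<Sum>i<d. \<Sum>j<e. v $ i * M $$ (i, j) * w $ j)"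
    by (simp add: sum_distrib_right sum.swap[of _ "{..<d}"])
qed

text \<open>Nesting to the left makes the position of the last factor vary fastest, so a triple of
  block rows sits at \<open>(r * a + u) * p' + s\<close>, and likewise for columns; dividing by
  \<open>p'\<close> and then by \<open>a\<close> recovers it.\<close>

lemma contract_blocks:
  assumes B: "B \<in> block_mats p q (carrier_vec d)" and M: "M \<in> block_mats a b (carrier_mat d e)"
    and C: "C \<in> block_mats p' q' (carrier_vec e)"
  defines "T \<equiv> map_mat tensor_of_vec B \<times>\<^sub>b\<^sup>1 map_mat tensor_of_mat M \<times>\<^sub>b\<^sup>1 map_mat tensor_of_vec C"
  shows contract_blocks_scalar: "T \<in> block_mats (p * a * p') (q * b * q') {t. dims t = []}"
    and contract_blocks_entry: "r < p \<Longrightarrow> u < a \<Longrightarrow> s < p' \<Longrightarrow> r' < q \<Longrightarrow> u' < b \<Longrightarrow> s' < q' \<Longrightarrow>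
      entry (T $$ ((r * a + u) * p' + s, (r' * b + u') * q' + s')) [] =
      (\<Sum>i<d. \<Sum>j<e. B $$ (r, r') $ i * M $$ (u, u') $$ (i, j) * C $$ (s, s') $ j)"
proof -
  have T: "T \<in> carrier_mat (p * a * p') (q * b * q')"
    using B M C by (auto simp: T_def block_contract_def block_mats_iff)
  have block: "T $$ (i, j) = tensor_of_vec (B $$ (i div p' div a, j div q' div b))
      \<times>\<^sup>1 tensor_of_mat (M $$ (i div p' mod a, j div q' mod b)) \<times>\<^sup>1 tensor_of_vec (C $$ (i mod p', j mod q'))"
    and range: "i div p' div a < p" "j div q' div b < q" "i div p' mod a < a" "j div q' mod b < b"
      "i mod p' < p'" "j mod q' < q'"
    if "i < p * a * p'" "j < q * b * q'" for i j
  proof -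
    have ij: "i div p' < p * a" "j div q' < q * b"
      using that by (auto intro: less_mult_imp_div_less)
    have pos: "0 < p'" "0 < a" "0 < q'" "0 < b" using that by (auto intro: Nat.gr0I)
    show range: "i div p' div a < p" "j div q' div b < q" "i div p' mod a < a" "j div q' mod b < b"
      "i mod p' < p'" "j mod q' < q'"
      using ij pos by (auto intro: less_mult_imp_div_less)
    have dims: "dim_row B = p" "dim_col B = q" "dim_row M = a" "dim_col M = b"
      "dim_row C = p'" "dim_col C = q'"
      using B M C by (auto simp: block_mats_iff)
    show "T $$ (i, j) = tensor_of_vec (B $$ (i div p' div a, j div q' div b))
      \<times>\<^sup>1 tensor_of_mat (M $$ (i div p' mod a, j div q' mod b)) \<times>\<^sup>1 tensor_of_vec (C $$ (i mod p', j mod q'))"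
      using that ij range by (simp add: T_def block_contract_def dims)
  qed
  show "T \<in> block_mats (p * a * p') (q * b * q') {t. dims t = []}"
    unfolding block_mats_iff
  proof (intro conjI allI impI CollectI T)
    fix i j assume ij: "i < p * a * p'" "j < q * b * q'"
    show "dims (T $$ (i, j)) = []"
      unfolding block[OF ij] using range[OF ij] B M C
      by (intro contract_vec_mat_vec(1)) (auto simp: block_mats_iff)
  qed
  show "entry (T $$ ((r * a + u) * p' + s, (r' * b + u') * q' + s')) [] =
      (\<Sum>i<d. \<Sum>j<e. B $$ (r, r') $ i * M $$ (u, u') $$ (i, j) * C $$ (s, s') $ j)"
    if *: "r < p" "u < a" "s < p'" "r' < q" "u' < b" "s' < q'"
  proof -
    have ij: "(r * a + u) * p' + s < p * a * p'" "(r' * b + u') * q' + s' < q * b * q'"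
      using * by (auto intro!: mult_add_less)
    have "T $$ ((r * a + u) * p' + s, (r' * b + u') * q' + s') =
      tensor_of_vec (B $$ (r, r')) \<times>\<^sup>1 tensor_of_mat (M $$ (u, u')) \<times>\<^sup>1 tensor_of_vec (C $$ (s, s'))"
      unfolding block[OF ij] using * by simp
    then show ?thesis using * B M C
      by (simp add: contract_vec_mat_vec(2)[of _ d _ e] block_mats_iff)
  qed
qed

section \<open>Bilinear forms of tensor trains\<close>

text \<open>Moves one sum outwards past three others; applied four times in the next lemma.\<close>

lemma sum_swap_triple:
  "(\<Sum>r\<in>A. \<Sum>u\<in>B. \<Sum>s\<in>C. \<Sum>i\<in>D. h r u s i) = (\<Sum>i\<in>D. \<Sum>r\<in>A. \<Sum>u\<in>B. \<Sum>s\<in>C. h r u s i)"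
proof -
  have "(\<Sum>r\<in>A. \<Sum>u\<in>B. \<Sum>s\<in>C. \<Sum>i\<in>D. h r u s i) = (\<Sum>r\<in>A. \<Sum>u\<in>B. \<Sum>i\<in>D. \<Sum>s\<in>C. h r u s i)"
    by (intro sum.cong refl sum.swap)
  also have "\<dots> = (\<Sum>r\<in>A. \<Sum>i\<in>D. \<Sum>u\<in>B. \<Sum>s\<in>C. h r u s i)"
    by (intro sum.cong refl sum.swap)
  also have "\<dots> = (\<Sum>i\<in>D. \<Sum>r\<in>A. \<Sum>u\<in>B. \<Sum>s\<in>C. h r u s i)"
    by (rule sum.swap)
  finally show ?thesis .
qed

text \<open>Appends one core to a bilinear form: \<open>f\<close>, \<open>g\<close>,
  \<open>h\<close> stand for the cores so far, the primed functions for the next core, and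
  \<open>r\<close>, \<open>u\<close>, \<open>s\<close> for the ranks they share. Each factor depends
  on one rank only, so the rank sums factor. The order \<open>i\<close>, \<open>k\<close>,
  \<open>j\<close>, \<open>l\<close> puts the digits of each flat index side by side.\<close>

lemma sum_bilinear_step:
  fixes f f' h h' :: "'a \<Rightarrow> 'b \<Rightarrow> real"
  shows "(\<Sum>r\<in>A. \<Sum>u\<in>B. \<Sum>s\<in>C. (\<Sum>i\<in>D. \<Sum>j\<in>D. f i r * g i j u * h j s)
      * (\<Sum>k\<in>E. \<Sum>l\<in>E. f' k r * g' u k l * h' l s)) =
    (\<Sum>i\<in>D. \<Sum>k\<in>E. \<Sum>j\<in>D. \<Sum>l\<in>E.
      (\<Sum>r\<in>A. f i r * f' k r) * (\<Sum>u\<in>B. g i j u * g' u k l) * (\<Sum>s\<in>C. h j s * h' l s))"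
proof -
  let ?t = "\<lambda>i k j l r u s. (f i r * f' k r) * (g i j u * g' u k l) * (h j s * h' l s)"
  have "(\<Sum>i\<in>D. \<Sum>j\<in>D. f i r * g i j u * h j s) * (\<Sum>k\<in>E. \<Sum>l\<in>E. f' k r * g' u k l * h' l s)
      = (\<Sum>i\<in>D. \<Sum>k\<in>E. \<Sum>j\<in>D. \<Sum>l\<in>E. ?t i k j l r u s)" for r u s
    by (simp only: sum_product) (simp only: mult_ac)
  then have "(\<Sum>r\<in>A. \<Sum>u\<in>B. \<Sum>s\<in>C. (\<Sum>i\<in>D. \<Sum>j\<in>D. f i r * g i j u * h j s)
      * (\<Sum>k\<in>E. \<Sum>l\<in>E. f' k r * g' u k l * h' l s)) =
      (\<Sum>r\<in>A. \<Sum>u\<in>B. \<Sum>s\<in>C. \<Sum>i\<in>D. \<Sum>k\<in>E. \<Sum>j\<in>D. \<Sum>l\<in>E. ?t i k j l r u s)"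
    by simp
  also have "\<dots> = (\<Sum>i\<in>D. \<Sum>k\<in>E. \<Sum>j\<in>D. \<Sum>l\<in>E. \<Sum>r\<in>A. \<Sum>u\<in>B. \<Sum>s\<in>C. ?t i k j l r u s)"
    \<comment> \<open>Fixing the three rank sets keeps the rewriting from looping, since the
      right-hand side again has the shape of the left.\<close>
    unfolding sum_swap_triple[where A = A and B = B and C = C] ..
  also have "\<dots> = (\<Sum>i\<in>D. \<Sum>k\<in>E. \<Sum>j\<in>D. \<Sum>l\<in>E.
      (\<Sum>r\<in>A. f i r * f' k r) * (\<Sum>u\<in>B. g i j u * g' u k l) * (\<Sum>s\<in>C. h j s * h' l s))"
    by (intro sum.cong refl) (simp only: sum_distrib_left[symmetric] sum_distrib_right[symmetric])
  finally show ?thesis .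
qed

lemma fiber_blocks_block_mats:
  "dims T = [p, d, q] \<Longrightarrow> fiber_blocks T \<in> block_mats p q (carrier_vec d)"
  by (simp add: fiber_blocks_def block_mats_iff)

lemma fiber_blocks_index:
  "dims T = [p, d, q] \<Longrightarrow> r < p \<Longrightarrow> i < d \<Longrightarrow> s < q \<Longrightarrow> fiber_blocks T $$ (r, s) $ i = entry T [r, i, s]"
  by (simp add: fiber_blocks_def)

text \<open>Two separate trains \<open>V\<close> and \<open>W\<close> are allowed because they will
  differ at core \<open>n\<close>. The last ranks are arbitrary, as the induction on
  \<open>m\<close> needs every block of the shorter chain. For 1 by 1 blocks the strong Kronecker
  product is matrix multiplication, so each step sums over triples of shared ranks.\<close>

lemma tt_bilinear_form:
  assumes V: "tt_cores I R N V" and W: "tt_cores I R N W"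
    and Ab: "\<And>m. m \<in> {1..N} \<Longrightarrow> Ab m \<in> block_mats (RA (m - 1)) (RA m) (carrier_mat (I m) (I m))"
    and R_pos: "\<And>m. m \<in> {0..N} \<Longrightarrow> 0 < R m" and RA_pos: "\<And>m. m \<in> {0..N} \<Longrightarrow> 0 < RA m"
    and boundary: "R 0 = 1" "RA 0 = 1"
    and Z: "\<And>m. m \<in> {1..N} \<Longrightarrow> Z m = map_mat tensor_of_vec (fiber_blocks (V m))
      \<times>\<^sub>b\<^sup>1 map_mat tensor_of_mat (Ab m) \<times>\<^sub>b\<^sup>1 map_mat tensor_of_vec (fiber_blocks (W m))"
    and "1 \<le> m" "m \<le> N" "r < R m" "u < RA m" "s < R m"
  shows "strong_kronecker_chain (\<lambda>m. scalar_blocks (Z m)) m $$ (0, (r * RA m + u) * R m + s) $$ (0, 0) =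
    (\<Sum>i<\<Prod>k=1..m. I k. \<Sum>j<\<Prod>k=1..m. I k.
      tt_entry V 0 m i 0 r * strong_kronecker_chain Ab m $$ (0, u) $$ (i, j) * tt_entry W 0 m j 0 s)"
proof -
  \<comment> \<open>The number of rank triples at position \<open>m\<close>.\<close>
  define D where "D = (\<lambda>m. R m * RA m * R m)"
  let ?Z = "\<lambda>m. scalar_blocks (Z m)"
  have dims: "dims (V m) = [R (m - 1), I m, R m]" "dims (W m) = [R (m - 1), I m, R m]"
    if "m \<in> {1..N}" for m
    using V W that by (auto simp: tt_cores_def)
  have Zb: "Z m \<in> block_mats (D (m - 1)) (D m) {t. dims t = []}" if "m \<in> {1..N}" for m
    unfolding Z[OF that] D_def
    by (rule contract_blocks_scalar[OF fiber_blocks_block_mats[OF dims(1)[OF that]] Ab[OF that]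
          fiber_blocks_block_mats[OF dims(2)[OF that]]])
  have sZb: "?Z m \<in> block_mats (D (m - 1)) (D m) (carrier_mat 1 1)" if "m \<in> {1..N}" for m
    using Zb[OF that] by (auto simp: block_mats_iff scalar_blocks_def scalar_matrix_def)
  have Zentry: "?Z m $$ ((r * RA (m - 1) + u) * R (m - 1) + s, (r' * RA m + u') * R m + s') $$ (0, 0) =
      (\<Sum>i<I m. \<Sum>j<I m. entry (V m) [r, i, r'] * Ab m $$ (u, u') $$ (i, j) * entry (W m) [s, j, s'])"
    if m: "m \<in> {1..N}" and ind: "r < R (m - 1)" "u < RA (m - 1)" "s < R (m - 1)" "r' < R m" "u' < RA m" "s' < R m"
    for m r u s r' u' s'
  proof -
    have ij: "(r * RA (m - 1) + u) * R (m - 1) + s < D (m - 1)" "(r' * RA m + u') * R m + s' < D m"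
      using ind by (auto simp: D_def intro!: mult_add_less)
    have "?Z m $$ ((r * RA (m - 1) + u) * R (m - 1) + s, (r' * RA m + u') * R m + s') $$ (0, 0) =
      entry (Z m $$ ((r * RA (m - 1) + u) * R (m - 1) + s, (r' * RA m + u') * R m + s')) []"
      using block_mats_dim[OF Zb[OF m]] ij by (simp add: scalar_blocks_def scalar_matrix_def)
    also have "\<dots> = (\<Sum>i<I m. \<Sum>j<I m. fiber_blocks (V m) $$ (r, r') $ i * Ab m $$ (u, u') $$ (i, j)
        * fiber_blocks (W m) $$ (s, s') $ j)"
      unfolding Z[OF m]
      by (rule contract_blocks_entry[OF fiber_blocks_block_mats[OF dims(1)[OF m]] Ab[OF m]
            fiber_blocks_block_mats[OF dims(2)[OF m]] ind(1-6)])
    also have "\<dots> = (\<Sum>i<I m. \<Sum>j<I m. entry (V m) [r, i, r'] * Ab m $$ (u, u') $$ (i, j) * entry (W m) [s, j, s'])"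
      using fiber_blocks_index[OF dims(1)[OF m]] fiber_blocks_index[OF dims(2)[OF m]] ind by simp
    finally show ?thesis .
  qed
  show ?thesis using assms(9-13)
  proof (induction m arbitrary: r u s rule: nat_induct_at_least)
    \<comment> \<open>All ranks at position 0 are 0, so the chain consists of the single row of the
      first block matrix.\<close>
    case base
    then have "1 \<in> {1..N}" by simp
    from Zentry[OF this, of 0 0 0 r u s] base show ?case
      using tt_entry_1[OF V, of 0 0] tt_entry_1[OF W, of 0 0]
      by (simp add: strong_kronecker_chain_1[simplified] boundary del: tt_entry.simps)
  next
    case (Suc m)
    define d where "d = I (Suc m)"
    define P where "P = (\<Prod>k=1..m. I k)"
    have Pd: "(\<Prod>k=1..Suc m. I k) = P * d" by (simp add: P_def d_def)
    have m: "Suc m \<in> {1..N}" "m \<in> {0..N}" "m < N" using Suc by auto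
    have posD: "0 < D m" using R_pos[OF m(2)] RA_pos[OF m(2)] by (simp add: D_def)
    have cZ: "strong_kronecker_chain ?Z m \<in> block_mats 1 (D m) (carrier_mat 1 1)"
      using strong_kronecker_chain_block_mats[of N ?Z D "\<lambda>_. 1" "\<lambda>_. 1" m] sZb R_pos RA_pos Suc.hyps m
      by (simp add: boundary D_def)
    have cA: "strong_kronecker_chain Ab m \<in> block_mats 1 (RA m) (carrier_mat P P)"
      using strong_kronecker_chain_block_mats[of N Ab RA I I m] Ab RA_pos Suc.hyps m
      by (simp add: boundary P_def)
    have A: "strong_kronecker_chain Ab (Suc m) $$ (0, u) $$ (i * d + k, j * d + l) =
        (\<Sum>t<RA m. strong_kronecker_chain Ab m $$ (0, t) $$ (i, j) * Ab (Suc m) $$ (t, u) $$ (k, l))"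
      if "i < P" "j < P" "k < d" "l < d" for i j k l
      using strong_kronecker_index[OF cA, of "Ab (Suc m)" "RA (Suc m)" d d 0 u "i * d + k" "j * d + l"]
        Ab[OF m(1)] RA_pos[OF m(2)] Suc.prems Suc.hyps that
      by (simp add: strong_kronecker_chain_Suc d_def[symmetric] mult_add_less)
    have G: "tt_entry X 0 (Suc m) (i * d + k) 0 r =
        (\<Sum>t<R m. tt_entry X 0 m i 0 t * entry (X (Suc m)) [t, k, r])"
      if "tt_cores I R N X" "k < d" for X i k r
      using tt_entry_Suc[OF that(1), of 0 m "i * d + k" 0 r] m that(2) by (simp add: d_def)
    have col: "(r * RA (Suc m) + u) * R (Suc m) + s < D (Suc m)"
      using Suc.prems by (auto simp: D_def intro!: mult_add_less)
    let ?c = "(r * RA (Suc m) + u) * R (Suc m) + s"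
    have "strong_kronecker_chain ?Z (Suc m) $$ (0, ?c) $$ (0, 0) =
        (\<Sum>t<D m. strong_kronecker_chain ?Z m $$ (0, t) $$ (0, 0) * ?Z (Suc m) $$ (t, ?c) $$ (0, 0))"
      using strong_kronecker_index[OF cZ, of "?Z (Suc m)" "D (Suc m)" 1 1 0 ?c 0 0] sZb[OF m(1)]
        posD col Suc.hyps
      by (simp add: strong_kronecker_chain_Suc)
    \<comment> \<open>The inner index of the matrix product is decoded into a triple of
      ranks.\<close>
    also have "\<dots> = (\<Sum>r'<R m. \<Sum>u'<RA m. \<Sum>s'<R m.
        strong_kronecker_chain ?Z m $$ (0, (r' * RA m + u') * R m + s') $$ (0, 0)
        * ?Z (Suc m) $$ ((r' * RA m + u') * R m + s', ?c) $$ (0, 0))"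
      unfolding D_def sum_lessThan_mult ..
    also have "\<dots> = (\<Sum>r'<R m. \<Sum>u'<RA m. \<Sum>s'<R m.
        (\<Sum>i<P. \<Sum>j<P. tt_entry V 0 m i 0 r' * strong_kronecker_chain Ab m $$ (0, u') $$ (i, j) * tt_entry W 0 m j 0 s')
        * (\<Sum>k<d. \<Sum>l<d. entry (V (Suc m)) [r', k, r] * Ab (Suc m) $$ (u', u) $$ (k, l) * entry (W (Suc m)) [s', l, s]))"
      using Suc.IH Zentry[OF m(1)] Suc.prems by (intro sum.cong refl) (simp add: P_def d_def)
    also have "\<dots> = (\<Sum>i<P. \<Sum>k<d. \<Sum>j<P. \<Sum>l<d.
        (\<Sum>r'<R m. tt_entry V 0 m i 0 r' * entry (V (Suc m)) [r', k, r])
        * (\<Sum>u'<RA m. strong_kronecker_chain Ab m $$ (0, u') $$ (i, j) * Ab (Suc m) $$ (u', u) $$ (k, l))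
        * (\<Sum>s'<R m. tt_entry W 0 m j 0 s' * entry (W (Suc m)) [s', l, s]))"
      by (rule sum_bilinear_step)
    \<comment> \<open>Each rank sum is the recursion step of its own train, for \<open>V\<close>,
      \<open>A\<close> and \<open>W\<close>, at the flat indices \<open>i * d + k\<close> and
      \<open>j * d + l\<close>.\<close>
    also have "\<dots> = (\<Sum>i<P. \<Sum>k<d. \<Sum>j<P. \<Sum>l<d. tt_entry V 0 (Suc m) (i * d + k) 0 r
        * strong_kronecker_chain Ab (Suc m) $$ (0, u) $$ (i * d + k, j * d + l)
        * tt_entry W 0 (Suc m) (j * d + l) 0 s)"
      using A G[OF V] G[OF W] by (intro sum.cong refl) (simp del: tt_entry.simps)
    also have "\<dots> = (\<Sum>i<P * d. \<Sum>j<P * d. tt_entry V 0 (Suc m) i 0 r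
        * strong_kronecker_chain Ab (Suc m) $$ (0, u) $$ (i, j) * tt_entry W 0 (Suc m) j 0 s)"
      unfolding sum_lessThan_mult ..
    finally show ?case unfolding Pd .
  qed
qed

section \<open>The bilinear form of the projected matrix\<close>

theorem proposition4p2:
  fixes N n :: nat and I R RA :: "nat \<Rightarrow> nat"
    and x :: "real vec" and A :: "real mat"
    and Xb :: "nat \<Rightarrow> real vec mat" and Ab :: "nat \<Rightarrow> real mat mat"
    and Xframe Abar :: "real mat"
    and y w :: "real vec" and Y W :: tensor
    and Z :: "nat \<Rightarrow> tensor mat"
  assumes n: "1 \<le> n" "n \<le> N"
    and I_pos: "\<And>m. m \<in> {1..N} \<Longrightarrow> 0 < I m"
    and R_pos: "\<And>m. m \<in> {0..N} \<Longrightarrow> 0 < R m"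
    and RA_pos: "\<And>m. m \<in> {0..N} \<Longrightarrow> 0 < RA m"
    and boundary: "R 0 = 1" "R N = 1" "RA 0 = 1" "RA N = 1"
    and x: "x \<in> carrier_vec (\<Prod>m=1..N. I m)"
    and A: "A \<in> carrier_mat (\<Prod>m=1..N. I m) (\<Prod>m=1..N. I m)"
    and Xb: "\<And>m. m \<in> {1..N} \<Longrightarrow> Xb m \<in> block_mats (R (m - 1)) (R m) (carrier_vec (I m))"
    and Ab: "\<And>m. m \<in> {1..N} \<Longrightarrow> Ab m \<in> block_mats (RA (m - 1)) (RA m) (carrier_mat (I m) (I m))"
    and x_TT: "single_block (column_matrix x) = strong_kronecker_chain (\<lambda>m. vec_blocks (Xb m)) N"
    and A_TT: "single_block A = strong_kronecker_chain Ab N"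
    and Xframe: "Xframe = frame_matrix (\<lambda>m. tt_core (I m) (Xb m)) I N n"
    and Abar: "Abar = Xframe\<^sup>T * A * Xframe"
    and y: "y \<in> carrier_vec (R (n - 1) * I n * R n)"
    and w: "w \<in> carrier_vec (R (n - 1) * I n * R n)"
    and Y: "dims Y = [R (n - 1), I n, R n]" "y = vectorize Y"
    and W: "dims W = [R (n - 1), I n, R n]" "w = vectorize W"
    and Z: "\<And>m. m \<in> {1..N} - {n} \<Longrightarrow>
        Z m = map_mat tensor_of_vec (Xb m) \<times>\<^sub>b\<^sup>1 map_mat tensor_of_mat (Ab m)
              \<times>\<^sub>b\<^sup>1 map_mat tensor_of_vec (Xb m)"
    and Zn: "Z n = map_mat tensor_of_vec (fiber_blocks Y) \<times>\<^sub>b\<^sup>1 map_mat tensor_of_mat (Ab n)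
              \<times>\<^sub>b\<^sup>1 map_mat tensor_of_vec (fiber_blocks W)"
  shows "Xframe \<in> carrier_mat (\<Prod>m=1..N. I m) (R (n - 1) * I n * R n) \<and>
    Abar \<in> carrier_mat (R (n - 1) * I n * R n) (R (n - 1) * I n * R n) \<and>
    (\<forall>m \<in> {1..N}. Z m \<in> block_mats (RA (m - 1) * (R (m - 1))\<^sup>2) (RA m * (R m)\<^sup>2) {t. dims t = []}) \<and>
    single_block (scalar_matrix (y \<bullet> (Abar *\<^sub>v w))) =
      strong_kronecker_chain (\<lambda>m. scalar_blocks (Z m)) N"
proof -
  define X where "X = (\<lambda>m. tt_core (I m) (Xb m))"
  let ?D = "R (n - 1) * I n * R n" and ?P = "\<Prod>m=1..N. I m"
  have X: "tt_cores I R N X"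
    using block_mats_dim[OF Xb] by (simp add: tt_cores_def X_def tt_core_def)
  have XY: "tt_cores I R N (X(n := Y))" and XW: "tt_cores I R N (X(n := W))"
    using X Y(1) W(1) by (auto simp: tt_cores_def)
  have F: "Xframe \<in> carrier_mat ?P ?D"
    unfolding Xframe X_def[symmetric] using frame_matrix_carrier[OF X n boundary(1,2)] .
  have Abar_carrier: "Abar \<in> carrier_mat ?D ?D"
    using F A by (simp add: Abar)
  have fX: "fiber_blocks (X m) = Xb m" if "m \<in> {1..N}" for m
    unfolding X_def using fiber_blocks_tt_core[OF Xb[OF that]] .
  \<comment> \<open>Away from \<open>n\<close> both updated trains still have the core
    \<open>X m\<close>, whose fiber blocks are \<open>Xb m\<close>; at \<open>n\<close> they have
    \<open>Y\<close> and \<open>W\<close>. One formula thus covers every \<open>m\<close>.\<close>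
  have ZYW: "Z m = map_mat tensor_of_vec (fiber_blocks ((X(n := Y)) m)) \<times>\<^sub>b\<^sup>1 map_mat tensor_of_mat (Ab m)
      \<times>\<^sub>b\<^sup>1 map_mat tensor_of_vec (fiber_blocks ((X(n := W)) m))" if "m \<in> {1..N}" for m
    using Z[of m] Zn that fX[OF that] by (cases "m = n") auto
  have Z_carrier: "Z m \<in> block_mats (RA (m - 1) * (R (m - 1))\<^sup>2) (RA m * (R m)\<^sup>2) {t. dims t = []}"
    if "m \<in> {1..N}" for m
  proof -
    have "Z m \<in> block_mats (R (m - 1) * RA (m - 1) * R (m - 1)) (R m * RA m * R m) {t. dims t = []}"
      unfolding ZYW[OF that] using XY XW Ab[OF that] that
      by (intro contract_blocks_scalar[where d = "I m" and e = "I m"] fiber_blocks_block_mats)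
        (simp_all add: tt_cores_def)
    then show ?thesis by (simp add: power2_eq_square mult_ac)
  qed
  have sZ: "scalar_blocks (Z m) \<in> block_mats (RA (m - 1) * (R (m - 1))\<^sup>2) (RA m * (R m)\<^sup>2) (carrier_mat 1 1)"
    if "m \<in> {1..N}" for m
    using Z_carrier[OF that] by (auto simp: block_mats_iff scalar_blocks_def scalar_matrix_def)
  have chain: "strong_kronecker_chain (\<lambda>m. scalar_blocks (Z m)) N \<in> block_mats 1 1 (carrier_mat 1 1)"
    using strong_kronecker_chain_block_mats[of N "\<lambda>m. scalar_blocks (Z m)" "\<lambda>m. RA m * (R m)\<^sup>2"
        "\<lambda>_. 1" "\<lambda>_. 1" N] sZ R_pos RA_pos n
    by (simp add: boundary)
  have Fw: "(Xframe *\<^sub>v vectorize T) $ i = tt_entry (X(n := T)) 0 N i 0 0"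
    if "dims T = [R (n - 1), I n, R n]" "i < ?P" for T i
    unfolding Xframe X_def[symmetric] using frame_matrix_mult_vectorize[OF X n boundary(1,2) that] .
  have Fy_carrier: "Xframe *\<^sub>v y \<in> carrier_vec ?P" and Fw_carrier: "Xframe *\<^sub>v w \<in> carrier_vec ?P"
    using F y w by auto
  have AFw: "A *\<^sub>v (Xframe *\<^sub>v w) \<in> carrier_vec ?P"
    by (rule mult_mat_vec_carrier[OF A Fw_carrier])
  have A00: "strong_kronecker_chain Ab N $$ (0, 0) = A"
    unfolding A_TT[symmetric] by (simp add: single_block_def)
  have "Abar *\<^sub>v w = Xframe\<^sup>T *\<^sub>v (A *\<^sub>v (Xframe *\<^sub>v w))"
    using F A w by (simp add: Abar assoc_mult_mat_vec[of _ ?D ?P _ ?D] assoc_mult_mat_vec[of _ ?D ?P _ ?P])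
  \<comment> \<open>The transposed frame matrix is moved to the other side of the scalar product,
    giving the form of \<open>A\<close> at \<open>Xframe y\<close> and
    \<open>Xframe w\<close>.\<close>
  then have "y \<bullet> (Abar *\<^sub>v w) = (Xframe\<^sup>T *\<^sub>v (A *\<^sub>v (Xframe *\<^sub>v w))) \<bullet> y"
    by (simp only: comm_scalar_prod[OF y mult_mat_vec_carrier[OF transpose_carrier_mat[THEN iffD2, OF F] AFw]])
  also have "\<dots> = (A *\<^sub>v (Xframe *\<^sub>v w)) \<bullet> (Xframe *\<^sub>v y)"
    by (rule transpose_vec_mult_scalar[OF F y AFw])
  also have "\<dots> = (Xframe *\<^sub>v y) \<bullet> (A *\<^sub>v (Xframe *\<^sub>v w))"
    by (rule comm_scalar_prod[OF AFw Fy_carrier])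
  also have "\<dots> = (\<Sum>i<?P. (Xframe *\<^sub>v y) $ i * (\<Sum>j<?P. A $$ (i, j) * (Xframe *\<^sub>v w) $ j))"
    using carrier_matD[OF A] carrier_vecD[OF Fw_carrier] carrier_vecD[OF AFw]
    by (simp add: scalar_prod_def[of "Xframe *\<^sub>v y"] scalar_prod_def[of "row A _"] lessThan_atLeast0)
  also have "\<dots> = (\<Sum>i<?P. \<Sum>j<?P. tt_entry (X(n := Y)) 0 N i 0 0
      * strong_kronecker_chain Ab N $$ (0, 0) $$ (i, j) * tt_entry (X(n := W)) 0 N j 0 0)"
    by (simp add: A00 sum_distrib_left mult.assoc Fw[OF Y(1)] Fw[OF W(1)] Y(2) W(2))
  \<comment> \<open>All ranks at \<open>N\<close> have size 1, so the only block is the one with all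
    last ranks 0.\<close>
  also have "\<dots> = strong_kronecker_chain (\<lambda>m. scalar_blocks (Z m)) N $$ (0, 0) $$ (0, 0)"
    using tt_bilinear_form[OF XY XW Ab R_pos RA_pos boundary(1,3) ZYW, of N 0 0 0] n
    by (simp add: boundary del: fun_upd_apply)
  \<comment> \<open>Both sides consist of one block of size 1 by 1, so equality of a single number
    suffices.\<close>
  finally have "single_block (scalar_matrix (y \<bullet> (Abar *\<^sub>v w)))
      = strong_kronecker_chain (\<lambda>m. scalar_blocks (Z m)) N"
    using chain by (intro eq_matI) (auto simp: block_mats_iff single_block_def scalar_matrix_def)
  with F Abar_carrier Z_carrier show ?thesis by blast
qed

end
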